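(* Let $k:\mathbb{R}^2\to\mathbb{R}$ be an even, measurable function with $\int_{\mathbb{R}^2}k(\zeta)\,d\zeta=1$, and suppose there are constants $M_0\ge m_0>0$ and $R_0\ge r_0>0$ such that $m_0\,\chi_{B_{r_0}}(\zeta)\le k(\zeta)\le M_0\,\chi_{B_{R_0}}(\zeta)$ for every $\zeta\in\mathbb{R}^2$. Let $f\in C^1(\mathbb{R})$ and let $u:\mathbb{R}^2\to\mathbb{R}$ be a $C^1$ function with $\|u\|_{C^1(\mathbb{R}^2)}<+\infty$ which satisfies $$\int_{\mathbb{R}^2}\big(u(x)-u(y)\big)\,k(x-y)\,dy=f\big(u(x)\big)\qquad\text{for every }x\in\mathbb{R}^2.$$ Assume that $\partial_{x_2}u(x)>0$ for every $x\in\mathbb{R}^2$. Then $u$ is one-dimensional, i.e. there exist a function $u_\star:\mathbb{R}\to\mathbb{R}$ and a vector $\omega\in\mathbb{R}^2$ such that $u(x)=u_\star(\omega\cdot x)$ for every $x\in\mathbb{R}^2$.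
   Context: $B_r$ denotes the ball of radius $r$ centered at the origin of $\mathbb{R}^2$, and $\chi_A$ is the characteristic function of the set $A$. A function $k$ is even if $k(-\zeta)=k(\zeta)$ for all $\zeta$. The norm $\|u\|_{C^1(\mathbb{R}^2)}<+\infty$ means that $u$ is continuously differentiable and that $u$ and its first partial derivatives are bounded on $\mathbb{R}^2$. *)

theory Defs
  imports "HOL-Analysis.Analysis"
begin

definition partial_deriv :: "'n::finite \<Rightarrow> (real ^ 'n \<Rightarrow> real) \<Rightarrow> real ^ 'n \<Rightarrow> real" where
  "partial_deriv i u x = deriv (\<lambda>t. u (x + t *\<^sub>R axis i 1)) 0"

definition C1_fun :: "(real ^ 'n::finite \<Rightarrow> real) \<Rightarrow> bool" where
  "C1_fun u \<longleftrightarrow>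
     (\<forall>x. u differentiable (at x)) \<and> (\<forall>i. continuous_on UNIV (partial_deriv i u))"

(* Finiteness of the C^1 norm over the whole space. *)
definition C1_norm_finite :: "(real ^ 'n::finite \<Rightarrow> real) \<Rightarrow> bool" where
  "C1_norm_finite u \<longleftrightarrow>
     C1_fun u \<and> bounded (range u) \<and> (\<forall>i. bounded (range (partial_deriv i u)))"

(* Nothing is required of the direction w, not even w \<noteq> 0, nor of the profile v. *)
definition one_dimensional :: "(real ^ 'n::finite \<Rightarrow> real) \<Rightarrow> bool" where
  "one_dimensional u \<longleftrightarrow>
     (\<exists>(v :: real \<Rightarrow> real) (w :: real ^ 'n). \<forall>x. u x = v (w \<bullet> x))"

end

theory Submission
  imports Defs
begin

text \<open>Differentiating the equation, \<open>v = \<partial>\<^sub>2 u\<close> and \<open>w = \<partial>\<^sub>1 u\<close> both solve \<open>k * v = c v\<close> with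
  \<open>c = 1 - f' \<circ> u\<close>. Hence \<open>\<sigma> = w / v\<close> satisfies
  \<open>\<integral> (\<sigma> x - \<sigma> y) v x v y k (x - y) dy = 0\<close>. Testing with \<open>\<tau>\<^sup>2 \<sigma>\<close> for a tent cutoff \<open>\<tau>\<close> at scale \<open>R\<close>
  gives a Caccioppoli estimate whose right-hand side stays bounded as \<open>R\<close> grows, because the
  dimension is two. So the energy \<open>\<integral>\<integral> (\<sigma> x - \<sigma> y)\<^sup>2 v x v y k (x - y)\<close> is finite; the cross term then
  only sees its tail, so the energy vanishes and \<open>\<sigma>\<close> is a constant \<open>a\<close>. Therefore \<open>u\<close> does not vary
  along \<open>(1, - a)\<close>.\<close>

section \<open>Reflections of Lebesgue measure and Young's inequality for the cross term\<close>

lemma lborel_distr_reflect: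
  fixes x :: "'a::euclidean_space"
  shows "distr lborel borel (\<lambda>y. x - y) = lborel"
  using lborel_affine[of "-1" x] by (simp add: density_1)

lemma AE_lborel_reflect:
  fixes x :: "'a::euclidean_space"
  assumes "AE y in lborel. P y"
  shows "AE y in lborel. P (x - y)"
proof (rule AE_distrD[where f = "\<lambda>y. x - y" and M' = lborel and P = P])
  show "AE y in distr lborel lborel (\<lambda>y. x - y). P y"
    using assms lborel_distr_reflect[of x] by (simp only: distr_cong[OF refl sets_lborel refl])
qed simp

lemma integral_reflect:
  fixes x :: "'a::euclidean_space" and g :: "'a \<Rightarrow> real"
  assumes "g \<in> borel_measurable borel"
  shows "(\<integral>y. g (x - y) \<partial>lborel) = (\<integral>y. g y \<partial>lborel)"
proof -
  have "(\<integral>y. g y \<partial>distr lborel borel (\<lambda>y. x - y)) = (\<integral>y. g (x - y) \<partial>lborel)"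
    by (rule integral_distr) (use assms in auto)
  then show ?thesis
    by (simp add: lborel_distr_reflect)
qed

text \<open>The two sides differ by the square of
  \<open>2 * e * ((a - b) * (s + t)) + (a + b) * (s - t)\<close> over \<open>4 * e\<close>. With
  values of \<open>ratio\<close> for \<open>a\<close>, \<open>b\<close> and of the cutoff for
  \<open>s\<close>, \<open>t\<close>, the first term is controlled by the energy and the second by
  the slope of the cutoff. The parameter \<open>e\<close> stays free because absorption and the
  final limit use different values.\<close>

lemma young_cutoff:
  fixes a b s t e :: real
  assumes "0 < e"
  shows "- (a\<^sup>2 - b\<^sup>2) * (s\<^sup>2 - t\<^sup>2) \<le> e * ((a - b)\<^sup>2 * (s + t)\<^sup>2) + (a + b)\<^sup>2 * (s - t)\<^sup>2 / (4 * e)"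
proof -
  have "0 \<le> (2 * e * ((a - b) * (s + t)) + (a + b) * (s - t))\<^sup>2 / (4 * e)"
    using assms by simp
  also have "\<dots> = e * ((a - b)\<^sup>2 * (s + t)\<^sup>2) + (a + b)\<^sup>2 * (s - t)\<^sup>2 / (4 * e) + (a\<^sup>2 - b\<^sup>2) * (s\<^sup>2 - t\<^sup>2)"
    using assms by (simp add: power2_eq_square field_simps)
  finally show ?thesis
    unfolding mult_minus_left by linarith
qed

section \<open>Tent cutoffs\<close>

definition tent :: "real \<Rightarrow> 'a::real_normed_vector \<Rightarrow> real" where
  "tent R x = max 0 (min 1 (2 - norm x / R))"

lemma tent_nonneg: "0 \<le> tent R x"
  and tent_le_1: "tent R x \<le> 1"
  by (auto simp: tent_def)

lemma tent_inner: "R > 0 \<Longrightarrow> norm x \<le> R \<Longrightarrow> tent R x = 1"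
  by (auto simp: tent_def field_simps)

lemma tent_outer: "R > 0 \<Longrightarrow> 2 * R \<le> norm x \<Longrightarrow> tent R x = 0"
  by (auto simp: tent_def field_simps)

lemma tent_lipschitz:
  assumes "R > 0"
  shows "\<bar>tent R x - tent R y\<bar> \<le> norm (x - y) / R"
proof -
  have "\<bar>tent R x - tent R y\<bar> \<le> \<bar>norm x / R - norm y / R\<bar>"
    by (auto simp: tent_def)
  also have "\<dots> = \<bar>norm x - norm y\<bar> / R"
    using assms by (simp add: diff_divide_distrib[symmetric])
  also have "\<dots> \<le> norm (x - y) / R"
    using assms by (intro divide_right_mono norm_triangle_ineq3) auto
  finally show ?thesis .
qed

lemma continuous_on_tent [continuous_intros]:
  "continuous_on A g \<Longrightarrow> continuous_on A (\<lambda>x. tent R (g x))"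
  unfolding tent_def divide_inverse by (intro continuous_intros)

section \<open>Convolutions and double integrals with a bounded even kernel of finite range\<close>

text \<open>Borel measurability and bounds at every point, rather than almost everywhere, let
  integrands be compared pointwise and make \<open>k (fst p - snd p)\<close> Borel on the product.
  The Lebesgue measurable kernel of the theorem is later replaced by such a kernel.\<close>

locale finite_range_kernel =
  fixes k :: "'a::euclidean_space \<Rightarrow> real" and M0 R0 :: real
  assumes k_borel [measurable]: "k \<in> borel_measurable borel"
    and k_even: "k (- z) = k z"
    and k_nonneg: "0 \<le> k z"
    and k_le: "k z \<le> M0"
    and k_range: "R0 \<le> norm z \<Longrightarrow> k z = 0"
    and R0_pos: "0 < R0"
begin

text \<open>Continuity bounds \<open>G\<close> on \<open>K\<close>, and \<open>M0\<close> bounds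
  \<open>k\<close>, so a multiple of the indicator of \<open>K\<close> dominates. The map
  \<open>h\<close> covers both \<open>x - y\<close> for fixed \<open>x\<close> and
  \<open>fst p - snd p\<close> on the product space.\<close>

lemma integrable_kernel_compact:
  fixes G :: "'b::euclidean_space \<Rightarrow> real" and h :: "'b \<Rightarrow> 'a"
  assumes G: "continuous_on UNIV G" and h: "continuous_on UNIV h"
    and K: "compact K" "\<And>p. p \<notin> K \<Longrightarrow> G p * k (h p) = 0"
  shows "integrable lborel (\<lambda>p. G p * k (h p))"
proof -
  have "bounded (G ` K)"
    by (intro compact_imp_bounded compact_continuous_image continuous_on_subset[OF G] K) auto
  then obtain B where B: "\<And>p. p \<in> K \<Longrightarrow> \<bar>G p\<bar> \<le> B"
    by (auto simp: bounded_real)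
  have [measurable]: "G \<in> borel_measurable borel" "h \<in> borel_measurable borel"
    using G h by (auto intro: borel_measurable_continuous_onI)
  show ?thesis
  proof (rule Bochner_Integration.integrable_bound[where f = "\<lambda>p. (B * M0) * indicat_real K p"])
    show "integrable lborel (\<lambda>p. (B * M0) * indicat_real K p)"
      using K(1) emeasure_compact_finite[OF K(1)]
      by (intro integrable_mult_right integrable_real_indicator)
        (auto simp: borel_compact)
    show "AE p in lborel. norm (G p * k (h p)) \<le> norm ((B * M0) * indicat_real K p)"
    proof (intro AE_I2)
      fix p
      show "norm (G p * k (h p)) \<le> norm ((B * M0) * indicat_real K p)"
      proof (cases "p \<in> K")
        case True
        then have "\<bar>G p\<bar> * \<bar>k (h p)\<bar> \<le> B * M0"
          using B k_le k_nonneg by (intro mult_mono) (auto intro: order_trans[OF abs_ge_zero])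
        then show ?thesis
          using True by (simp add: abs_mult[symmetric] order_trans[OF _ abs_ge_self])
      next
        case False
        then show ?thesis using K(2) by simp
      qed
    qed
  qed measurable
qed

lemma integrable_conv:
  assumes "continuous_on UNIV v"
  shows "integrable lborel (\<lambda>y. v y * k (x - y))"
proof (rule integrable_kernel_compact[where K = "cball x R0"])
  show "v y * k (x - y) = 0" if "y \<notin> cball x R0" for y
    using that k_range[of "x - y"] by (simp add: dist_norm)
qed (use assms in \<open>auto intro!: continuous_intros\<close>)

text \<open>If one point has norm below \<open>S\<close>, the finite range of \<open>k\<close> keeps
  the other below \<open>S + R0\<close>. Hence the integrand lives on a compact box although
  \<open>G\<close> itself may not.\<close>

lemma integrable_pair:
  fixes G :: "'a \<times> 'a \<Rightarrow> real"
  assumes "continuous_on UNIV G"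
    and G0: "\<And>x y. S \<le> norm x \<Longrightarrow> S \<le> norm y \<Longrightarrow> G (x, y) = 0"
  shows "integrable lborel (\<lambda>p. G p * k (fst p - snd p))"
proof (rule integrable_kernel_compact[where K = "cball 0 (S + R0) \<times> cball 0 (S + R0)"])
  show "G p * k (fst p - snd p) = 0" if p: "p \<notin> cball 0 (S + R0) \<times> cball 0 (S + R0)" for p
  proof (cases "norm (fst p - snd p) < R0")
    case True
    then have "\<bar>norm (fst p) - norm (snd p)\<bar> < R0"
      using norm_triangle_ineq3[of "fst p" "snd p"] by linarith
    moreover have "norm (fst p) > S + R0 \<or> norm (snd p) > S + R0"
      using p by (cases p) auto
    ultimately have "S \<le> norm (fst p)" "S \<le> norm (snd p)"
      using R0_pos by auto
    then show ?thesis
      using G0[of "fst p" "snd p"] by simp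
  qed (simp add: k_range)
qed (use assms in \<open>auto intro!: continuous_intros compact_Times\<close>)

lemma integral_pair_fst:
  fixes G :: "'a \<times> 'a \<Rightarrow> real"
  assumes "integrable lborel G"
  shows "(\<integral>p. G p \<partial>lborel) = (\<integral>x. (\<integral>y. G (x, y) \<partial>lborel) \<partial>lborel)"
  using lborel_pair.integral_fst'[of G] assms by (simp add: lborel_prod)

lemma integral_pair_swap:
  fixes G :: "'a \<times> 'a \<Rightarrow> real"
  assumes "integrable lborel G"
  shows "(\<integral>p. G (snd p, fst p) \<partial>lborel) = (\<integral>p. G p \<partial>lborel)"
  using lborel_pair.integral_product_swap[of G] borel_measurable_integrable[OF assms]
  by (simp add: lborel_prod case_prod_unfold)

end

section \<open>Two solutions of the linearised equation and their ratio\<close>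

locale kernel_pair = finite_range_kernel k M0 R0
  for k :: "'a::euclidean_space \<Rightarrow> real" and M0 R0 +
  fixes v w c :: "'a \<Rightarrow> real" and W C :: real
  assumes v_cont: "continuous_on UNIV v"
    and w_cont: "continuous_on UNIV w"
    and v_pos: "0 < v x"
    and w_bound: "\<bar>w x\<bar> \<le> W"
    and c_bound: "c x \<le> C"
    and v_conv: "(\<integral>y. v y * k (x - y) \<partial>lborel) = c x * v x"
    and w_conv: "(\<integral>y. w y * k (x - y) \<partial>lborel) = c x * w x"
begin

definition ratio :: "'a \<Rightarrow> real" where
  "ratio x = w x / v x"

lemma ratio_cont: "continuous_on UNIV ratio"
  unfolding ratio_def using v_cont w_cont v_pos
  by (intro continuous_intros) (auto simp: less_imp_neq[symmetric])

lemmas cont_intros = continuous_on_compose2[OF v_cont] continuous_on_compose2[OF w_cont]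
  continuous_on_compose2[OF ratio_cont] continuous_intros

text \<open>The locale bounds \<open>c\<close> only from above; the sign comes from convolving the
  positive \<open>v\<close> with a nonnegative kernel. It is what lets \<open>C\<close> be used as a
  bound inside products.\<close>

lemma c_nonneg: "0 \<le> c x"
proof -
  have "0 \<le> c x * v x"
    unfolding v_conv[symmetric]
    by (intro integral_nonneg_AE AE_I2 mult_nonneg_nonneg k_nonneg less_imp_le[OF v_pos])
  then show ?thesis
    using v_pos[of x] by (simp add: zero_le_mult_iff)
qed

lemma w_eq: "w x = ratio x * v x"
  using v_pos[of x] by (simp add: ratio_def)

abbreviation weight :: "'a \<times> 'a \<Rightarrow> real" where
  "weight p \<equiv> v (fst p) * v (snd p)"

text \<open>This is the weak form of the equation for \<open>ratio\<close>. Since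
  \<open>ratio x * v x = w x\<close>, the integrand is
  \<open>t x * (w x * v y - v x * w y) * k (x - y)\<close>; integrating in \<open>y\<close> first
  turns both terms into \<open>t x * c x * v x * w x\<close>, and they cancel.\<close>

lemma integral_test_zero:
  fixes t :: "'a \<Rightarrow> real"
  assumes t: "continuous_on UNIV t" and t0: "\<And>x. S \<le> norm x \<Longrightarrow> t x = 0"
  shows "(\<integral>p. (ratio (fst p) - ratio (snd p)) * t (fst p) * weight p * k (fst p - snd p) \<partial>lborel) = 0"
proof -
  let ?G = "\<lambda>p. (ratio (fst p) - ratio (snd p)) * t (fst p) * weight p * k (fst p - snd p)"
  have "integrable lborel ?G"
    by (rule integrable_pair[where S = S])
      (auto simp: t0 intro!: cont_intros continuous_on_compose2[OF t])
  then have "(\<integral>p. ?G p \<partial>lborel) = (\<integral>x. (\<integral>y. ?G (x, y) \<partial>lborel) \<partial>lborel)"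
    by (rule integral_pair_fst)
  also have "\<dots> = (\<integral>x. 0 \<partial>(lborel :: 'a measure))"
  proof (intro Bochner_Integration.integral_cong refl)
    fix x
    have "(\<integral>y. ?G (x, y) \<partial>lborel)
        = (\<integral>y. t x * w x * (v y * k (x - y)) - t x * v x * (w y * k (x - y)) \<partial>lborel)"
      by (intro Bochner_Integration.integral_cong refl) (simp add: w_eq algebra_simps)
    also have "\<dots> = t x * w x * (c x * v x) - t x * v x * (c x * w x)"
      by (subst Bochner_Integration.integral_diff)
        (simp_all add: integrable_conv v_cont w_cont v_conv w_conv)
    finally show "(\<integral>y. ?G (x, y) \<partial>lborel) = 0" by simp
  qed
  finally show ?thesis by simp
qed

text \<open>Testing with \<open>t\<^sup>2\<close> times \<open>ratio\<close> and adding the copy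
  with the two variables exchanged gives zero. As \<open>k\<close> is even, this sum splits into the
  symmetric energy part and the cross term.\<close>

lemma energy_identity:
  fixes t :: "'a \<Rightarrow> real"
  assumes t: "continuous_on UNIV t" and t0: "\<And>x. S \<le> norm x \<Longrightarrow> t x = 0"
  shows "(\<integral>p. (ratio (fst p) - ratio (snd p))\<^sup>2 * ((t (fst p))\<^sup>2 + (t (snd p))\<^sup>2) * weight p * k (fst p - snd p) \<partial>lborel)
    = (\<integral>p. - ((ratio (fst p))\<^sup>2 - (ratio (snd p))\<^sup>2) * ((t (fst p))\<^sup>2 - (t (snd p))\<^sup>2) * weight p * k (fst p - snd p) \<partial>lborel)"
    (is "(\<integral>p. ?P p \<partial>lborel) = (\<integral>p. ?N p \<partial>lborel)")
proof -
  let ?F = "\<lambda>p. (ratio (fst p) - ratio (snd p)) * (ratio (fst p) * (t (fst p))\<^sup>2) * weight p * k (fst p - snd p)"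
  have F: "integrable lborel ?F"
    by (rule integrable_pair[where S = S])
      (auto simp: t0 intro!: cont_intros continuous_on_compose2[OF t])
  have P: "integrable lborel ?P"
    by (rule integrable_pair[where S = S])
      (auto simp: t0 intro!: cont_intros continuous_on_compose2[OF t])
  have N: "integrable lborel ?N"
    by (rule integrable_pair[where S = S])
      (auto simp: t0 intro!: cont_intros continuous_on_compose2[OF t])
  have F0: "(\<integral>p. ?F p \<partial>lborel) = 0"
    by (rule integral_test_zero[where S = S]) (auto simp: t0 intro!: cont_intros t)
  have F': "(\<integral>p. ?F (snd p, fst p) \<partial>lborel) = 0"
    using integral_pair_swap[OF F] F0 by simp
  \<comment> \<open>With ratios a, b and cutoff values s, t this is (a - b)^2 (s^2 + t^2) + (a^2 -
    b^2) (s^2 - t^2) = 2 (a - b) (a s^2 - b t^2).\<close>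
  have PN: "?P p - ?N p = 2 * ?F p + 2 * ?F (snd p, fst p)" for p
    using k_even[of "fst p - snd p"] by (simp add: power2_eq_square algebra_simps)
  \<comment> \<open>The exchanged integrand inherits integrability from the identity;
    \<open>integral_pair_swap\<close> only gives its value.\<close>
  have "integrable lborel (\<lambda>p. ?P p - ?N p - 2 * ?F p)"
    using P N F by (intro Bochner_Integration.integrable_diff integrable_mult_right)
  then have F'_int: "integrable lborel (\<lambda>p. 2 * ?F (snd p, fst p))"
    unfolding PN by simp
  have "(\<integral>p. ?P p \<partial>lborel) - (\<integral>p. ?N p \<partial>lborel) = (\<integral>p. ?P p - ?N p \<partial>lborel)"
    using P N by simp
  also have "\<dots> = (\<integral>p. 2 * ?F p + 2 * ?F (snd p, fst p) \<partial>lborel)"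
    unfolding PN ..
  also have "\<dots> = (\<integral>p. 2 * ?F p \<partial>lborel) + (\<integral>p. 2 * ?F (snd p, fst p) \<partial>lborel)"
    by (rule Bochner_Integration.integral_add[OF integrable_mult_right[OF F] F'_int])
  also have "\<dots> = 0"
    using F0 F' by simp
  finally show ?thesis by simp
qed

text \<open>No Harnack inequality is needed: integrating \<open>v y * k (x - y)\<close> in \<open>y\<close> returns
  \<open>c x * v x\<close>, which turns the weight \<open>(ratio x)\<^sup>2 * v x\<close> into \<open>c x * (w x)\<^sup>2\<close>.\<close>

lemma cutoff_energy_half:
  fixes t :: "'a \<Rightarrow> real"
  assumes t: "continuous_on UNIV t" and t0: "\<And>x. S \<le> norm x \<Longrightarrow> t x = 0"
    and lip: "\<And>x y. \<bar>t x - t y\<bar> \<le> L * norm (x - y)" and "0 \<le> L"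
  shows "(\<integral>p. (ratio (fst p))\<^sup>2 * (t (fst p) - t (snd p))\<^sup>2 * weight p * k (fst p - snd p) \<partial>lborel)
    \<le> W\<^sup>2 * C * (L * R0)\<^sup>2 * measure lborel (ball (0::'a) (S + R0))"
proof -
  let ?G = "\<lambda>p. (ratio (fst p))\<^sup>2 * (t (fst p) - t (snd p))\<^sup>2 * weight p * k (fst p - snd p)"
  have G: "integrable lborel ?G"
    by (rule integrable_pair[where S = S])
      (auto simp: t0 intro!: cont_intros continuous_on_compose2[OF t])
  \<comment> \<open>Only pairs closer than \<open>R0\<close> are seen by \<open>k\<close>, so the
    Lipschitz bound becomes the constant \<open>L * R0\<close>.\<close>
  have pt: "(t x - t y)\<^sup>2 * k (x - y) \<le> (L * R0)\<^sup>2 * k (x - y)" for x y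
  proof (cases "norm (x - y) < R0")
    case True
    have "\<bar>t x - t y\<bar> \<le> L * R0"
      using lip[of x y] mult_left_mono[of "norm (x - y)" R0 L] True \<open>0 \<le> L\<close> by linarith
    then have "(t x - t y)\<^sup>2 \<le> (L * R0)\<^sup>2"
      by (metis abs_ge_zero power2_abs power_mono)
    then show ?thesis
      by (intro mult_right_mono k_nonneg)
  qed (simp add: k_range)
  have "(\<integral>p. ?G p \<partial>lborel) = (\<integral>x. (\<integral>y. ?G (x, y) \<partial>lborel) \<partial>lborel)"
    using G by (rule integral_pair_fst)
  also have "\<dots> \<le> (\<integral>x. W\<^sup>2 * C * (L * R0)\<^sup>2 * indicat_real (ball (0::'a) (S + R0)) x \<partial>lborel)"
  proof (rule Bochner_Integration.integral_mono)
    show "integrable lborel (\<lambda>x. \<integral>y. ?G (x, y) \<partial>lborel)"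
      using lborel_pair.integrable_fst'[of ?G] G by (simp add: lborel_prod)
    show "integrable lborel (\<lambda>x. W\<^sup>2 * C * (L * R0)\<^sup>2 * indicat_real (ball (0::'a) (S + R0)) x)"
      by (intro integrable_mult_right integrable_real_indicator)
        (use emeasure_bounded_finite[OF bounded_ball] in auto)
    show "(\<integral>y. ?G (x, y) \<partial>lborel) \<le> W\<^sup>2 * C * (L * R0)\<^sup>2 * indicat_real (ball 0 (S + R0)) x" for x
    proof (cases "norm x < S + R0")
      case True
      have "(\<integral>y. ?G (x, y) \<partial>lborel) \<le> (\<integral>y. (ratio x)\<^sup>2 * v x * (L * R0)\<^sup>2 * (v y * k (x - y)) \<partial>lborel)"
      proof (rule Bochner_Integration.integral_mono)
        show "integrable lborel (\<lambda>y. (ratio x)\<^sup>2 * v x * (L * R0)\<^sup>2 * (v y * k (x - y)))"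
          by (intro integrable_mult_right integrable_conv v_cont)
        have "integrable lborel (\<lambda>y. ((ratio x)\<^sup>2 * (t x - t y)\<^sup>2 * (v x * v y)) * k (x - y))"
          by (intro integrable_conv cont_intros continuous_on_compose2[OF t]) auto
        then show "integrable lborel (\<lambda>y. ?G (x, y))"
          by simp
        show "?G (x, y) \<le> (ratio x)\<^sup>2 * v x * (L * R0)\<^sup>2 * (v y * k (x - y))" for y
          using mult_left_mono[OF pt[of x y], of "(ratio x)\<^sup>2 * v x * v y"] v_pos[of x] v_pos[of y]
          by (simp add: mult_ac)
      qed
      also have "\<dots> = (ratio x)\<^sup>2 * v x * (L * R0)\<^sup>2 * (c x * v x)"
        by (simp add: v_conv)
      also have "\<dots> = (w x)\<^sup>2 * c x * (L * R0)\<^sup>2"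
        by (simp add: w_eq power2_eq_square mult_ac)
      also have "\<dots> \<le> W\<^sup>2 * C * (L * R0)\<^sup>2"
      proof (intro mult_right_mono mult_mono)
        show "(w x)\<^sup>2 \<le> W\<^sup>2"
          using w_bound[of x] by (metis abs_ge_zero power2_abs power_mono)
      qed (auto simp: c_bound c_nonneg)
      finally show ?thesis
        using True by simp
    next
      case False
      \<comment> \<open>Here \<open>norm x\<close> is at least \<open>S + R0\<close>, so every
        \<open>y\<close> within \<open>R0\<close> of \<open>x\<close> has norm at least
        \<open>S\<close> and both cutoff values vanish.\<close>
      have "?G (x, y) = 0" for y
      proof (cases "norm (x - y) < R0")
        case True
        then have "S \<le> norm y" "S \<le> norm x"
          using False norm_triangle_ineq2[of x y] R0_pos by linarith+
        then show ?thesis by (simp add: t0)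
      qed (simp add: k_range)
      then have "(\<integral>y. ?G (x, y) \<partial>lborel) = 0"
        by (intro integral_eq_zero_AE AE_I2)
      then show ?thesis
        using False by simp
    qed
  qed
  also have "\<dots> = W\<^sup>2 * C * (L * R0)\<^sup>2 * measure lborel (ball (0::'a) (S + R0))"
    by simp
  finally show ?thesis .
qed

text \<open>From (a + b)^2 \<le> 2 a^2 + 2 b^2. Exchanging the variables shows that the two
  resulting integrals agree, hence the factor 4.\<close>

lemma cutoff_energy:
  fixes t :: "'a \<Rightarrow> real"
  assumes t: "continuous_on UNIV t" and t0: "\<And>x. S \<le> norm x \<Longrightarrow> t x = 0"
    and lip: "\<And>x y. \<bar>t x - t y\<bar> \<le> L * norm (x - y)" and "0 \<le> L"
  shows "(\<integral>p. (ratio (fst p) + ratio (snd p))\<^sup>2 * (t (fst p) - t (snd p))\<^sup>2 * weight p * k (fst p - snd p) \<partial>lborel)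
    \<le> 4 * (W\<^sup>2 * C * (L * R0)\<^sup>2 * measure lborel (ball (0::'a) (S + R0)))"
    (is "(\<integral>p. ?Q p \<partial>lborel) \<le> _")
proof -
  let ?G = "\<lambda>p. (ratio (fst p))\<^sup>2 * (t (fst p) - t (snd p))\<^sup>2 * weight p * k (fst p - snd p)"
  let ?G' = "\<lambda>p. (ratio (snd p))\<^sup>2 * (t (fst p) - t (snd p))\<^sup>2 * weight p * k (fst p - snd p)"
  have G: "integrable lborel ?G"
    by (rule integrable_pair[where S = S])
      (auto simp: t0 intro!: cont_intros continuous_on_compose2[OF t])
  have G': "integrable lborel ?G'"
    by (rule integrable_pair[where S = S])
      (auto simp: t0 intro!: cont_intros continuous_on_compose2[OF t])
  have Q: "integrable lborel ?Q"
    by (rule integrable_pair[where S = S])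
      (auto simp: t0 intro!: cont_intros continuous_on_compose2[OF t])
  have "(\<integral>p. ?G' p \<partial>lborel) = (\<integral>p. ?G (snd p, fst p) \<partial>lborel)"
    using k_even[of "fst p - snd p" for p]
    by (intro Bochner_Integration.integral_cong refl) (simp add: power2_commute[of "t (snd _)"] mult_ac)
  also have "\<dots> = (\<integral>p. ?G p \<partial>lborel)"
    by (rule integral_pair_swap[OF G])
  finally have eq: "(\<integral>p. ?G' p \<partial>lborel) = (\<integral>p. ?G p \<partial>lborel)" .
  have "(\<integral>p. ?Q p \<partial>lborel) \<le> (\<integral>p. 2 * ?G p + 2 * ?G' p \<partial>lborel)"
  proof (rule Bochner_Integration.integral_mono[OF Q])
    show "integrable lborel (\<lambda>p. 2 * ?G p + 2 * ?G' p)"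
      using G G' by (intro Bochner_Integration.integrable_add integrable_mult_right)
    show "?Q p \<le> 2 * ?G p + 2 * ?G' p" for p
    proof -
      have "(ratio (fst p) + ratio (snd p))\<^sup>2 \<le> 2 * (ratio (fst p))\<^sup>2 + 2 * (ratio (snd p))\<^sup>2"
        using zero_le_power2[of "ratio (fst p) - ratio (snd p)"]
        by (simp add: power2_eq_square algebra_simps)
      from mult_right_mono[OF this, of "(t (fst p) - t (snd p))\<^sup>2 * (weight p * k (fst p - snd p))"]
      show ?thesis
        using v_pos[of "fst p"] v_pos[of "snd p"] k_nonneg[of "fst p - snd p"]
        by (simp add: distrib_right mult.assoc)
    qed
  qed
  also have "\<dots> = 4 * (\<integral>p. ?G p \<partial>lborel)"
    using G G' eq by simp
  also have "\<dots> \<le> 4 * (W\<^sup>2 * C * (L * R0)\<^sup>2 * measure lborel (ball (0::'a) (S + R0)))"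
    using cutoff_energy_half[OF t t0 lip \<open>0 \<le> L\<close>] by simp
  finally show ?thesis .
qed

text \<open>The squared Lipschitz constant \<open>1 / R\<^sup>2\<close> of the tent compensates the volume of its support only
  in dimension at most two.\<close>

lemma tent_energy_bounded:
  assumes dim: "DIM('a) \<le> 2"
  obtains K where "\<And>R. 1 \<le> R \<Longrightarrow> R0 \<le> R \<Longrightarrow>
    (\<integral>p. (ratio (fst p) + ratio (snd p))\<^sup>2 * (tent R (fst p) - tent R (snd p))\<^sup>2 * weight p * k (fst p - snd p) \<partial>lborel) \<le> K"
proof
  fix R :: real
  assume R: "1 \<le> R" "R0 \<le> R"
  \<comment> \<open>The power of 3 comes from \<open>2 * R + R0 \<le> 3 * R\<close>: the tent
    vanishes beyond \<open>2 * R\<close>, and the range of the kernel adds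
    \<open>R0\<close>.\<close>
  let ?\<omega> = "unit_ball_vol (real DIM('a)) * 3 ^ DIM('a)"
  have C: "0 \<le> C"
    using c_nonneg c_bound order_trans by blast
  have "measure lborel (ball (0::'a) (2 * R + R0)) \<le> ?\<omega> * R\<^sup>2"
  proof -
    have "(2 * R + R0) ^ DIM('a) \<le> (3 * R) ^ DIM('a)"
      using R R0_pos by (intro power_mono) auto
    \<comment> \<open>The assumption \<open>1 \<le> R\<close> is what permits raising the exponent
      from \<open>DIM('a)\<close> to 2.\<close>
    also have "\<dots> \<le> 3 ^ DIM('a) * R\<^sup>2"
      using R dim by (simp add: power_mult_distrib power_increasing)
    finally show ?thesis
      using R R0_pos by (simp add: content_ball mult_left_mono mult.assoc)
  qed
  then have "4 * (W\<^sup>2 * C * (1 / R * R0)\<^sup>2 * measure lborel (ball (0::'a) (2 * R + R0)))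
      \<le> 4 * (W\<^sup>2 * C * (1 / R * R0)\<^sup>2 * (?\<omega> * R\<^sup>2))"
    using C by (intro mult_left_mono) auto
  also have "\<dots> = 4 * (W\<^sup>2 * C * R0\<^sup>2 * ?\<omega>)"
    using R by (simp add: power2_eq_square)
  finally show "(\<integral>p. (ratio (fst p) + ratio (snd p))\<^sup>2 * (tent R (fst p) - tent R (snd p))\<^sup>2 * weight p * k (fst p - snd p) \<partial>lborel)
      \<le> 4 * (W\<^sup>2 * C * R0\<^sup>2 * ?\<omega>)"
    using R by (intro order_trans[OF cutoff_energy[where S = "2 * R" and L = "1 / R"]])
      (auto intro!: continuous_intros simp: tent_outer tent_lipschitz)
qed

section \<open>The nonlocal Dirichlet energy of \<open>ratio\<close> and its vanishing\<close>

definition energy :: "'a \<times> 'a \<Rightarrow> real" where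
  "energy p = (ratio (fst p) - ratio (snd p))\<^sup>2 * weight p * k (fst p - snd p)"

lemma energy_nonneg: "0 \<le> energy p"
  using v_pos[of "fst p"] v_pos[of "snd p"] by (simp add: energy_def k_nonneg)

lemma energy_measurable: "energy \<in> borel_measurable borel"
  unfolding energy_def
proof (rule borel_measurable_times)
  show "(\<lambda>p. (ratio (fst p) - ratio (snd p))\<^sup>2 * weight p) \<in> borel_measurable borel"
    by (intro borel_measurable_continuous_onI cont_intros) auto
  have "(\<lambda>p::'a \<times> 'a. fst p - snd p) \<in> borel_measurable borel"
    by (intro borel_measurable_continuous_onI cont_intros)
  then show "(\<lambda>p. k (fst p - snd p)) \<in> borel_measurable borel"
    by (rule measurable_compose[OF _ k_borel])
qed

lemma energy_tent_integrable:
  assumes "0 < R"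
  shows "integrable lborel (\<lambda>p. (ratio (fst p) - ratio (snd p))\<^sup>2 * ((tent R (fst p))\<^sup>2 + (tent R (snd p))\<^sup>2)
      * weight p * k (fst p - snd p))"
  by (rule integrable_pair[where S = "2 * R"])
    (use assms in \<open>auto simp: tent_outer intro!: cont_intros\<close>)

text \<open>On the box both tents equal 1, so their squares add up to the factor 2 on the left; off
  the box only nonnegativity is used.\<close>

lemma energy_box_pointwise:
  assumes "0 < R"
  shows "2 * (energy p * indicat_real (cball 0 R \<times> cball 0 R) p) \<le>
    (ratio (fst p) - ratio (snd p))\<^sup>2 * ((tent R (fst p))\<^sup>2 + (tent R (snd p))\<^sup>2) * weight p * k (fst p - snd p)"
proof (cases "p \<in> cball 0 R \<times> cball 0 R")
  case True
  then have "tent R (fst p) = 1" "tent R (snd p) = 1"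
    using assms by (auto simp: tent_inner)
  then show ?thesis
    using True by (simp add: energy_def)
next
  case False
  then show ?thesis
    using mult_nonneg_nonneg[OF energy_nonneg[of p], of "(tent R (fst p))\<^sup>2 + (tent R (snd p))\<^sup>2"]
    by (simp add: energy_def mult_ac)
qed

lemma energy_box_integrable:
  assumes "0 < R"
  shows "integrable lborel (\<lambda>p. energy p * indicat_real (cball 0 R \<times> cball 0 R) p)"
proof (rule Bochner_Integration.integrable_bound[OF energy_tent_integrable[OF assms]])
  have "(cball 0 R \<times> cball 0 R :: ('a \<times> 'a) set) \<in> sets borel"
    by (intro borel_closed closed_Times closed_cball)
  from borel_measurable_times[OF energy_measurable borel_measurable_indicator[OF this]]
  show "(\<lambda>p. energy p * indicat_real (cball 0 R \<times> cball 0 R) p) \<in> borel_measurable lborel"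
    unfolding measurable_lborel1 measurable_lborel2 .
  have "norm (energy p * indicat_real (cball 0 R \<times> cball 0 R) p)
      \<le> 2 * (energy p * indicat_real (cball 0 R \<times> cball 0 R) p)" for p
    using energy_nonneg[of p] by (simp split: split_indicator)
  then show "AE p in lborel. norm (energy p * indicat_real (cball 0 R \<times> cball 0 R) p) \<le>
      norm ((ratio (fst p) - ratio (snd p))\<^sup>2 * ((tent R (fst p))\<^sup>2 + (tent R (snd p))\<^sup>2)
      * weight p * k (fst p - snd p))"
    unfolding real_norm_def
    by (intro AE_I2) (rule order_trans[OF order_trans[OF _ energy_box_pointwise[OF assms]] abs_ge_self])
qed

lemma energy_box_le:
  assumes "0 < R"
  shows "2 * (\<integral>p. energy p * indicat_real (cball 0 R \<times> cball 0 R) p \<partial>lborel) \<le>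
    (\<integral>p. (ratio (fst p) - ratio (snd p))\<^sup>2 * ((tent R (fst p))\<^sup>2 + (tent R (snd p))\<^sup>2)
      * weight p * k (fst p - snd p) \<partial>lborel)"
proof -
  have "(\<integral>p. 2 * (energy p * indicat_real (cball 0 R \<times> cball 0 R) p) \<partial>lborel) \<le>
    (\<integral>p. (ratio (fst p) - ratio (snd p))\<^sup>2 * ((tent R (fst p))\<^sup>2 + (tent R (snd p))\<^sup>2)
      * weight p * k (fst p - snd p) \<partial>lborel)"
    by (intro Bochner_Integration.integral_mono integrable_mult_right energy_box_integrable[OF assms]
        energy_tent_integrable[OF assms] energy_box_pointwise[OF assms])
  then show ?thesis
    unfolding integral_mult_right_zero .
qed

text \<open>Young's inequality is applied twice to the cross term. With \<open>e = 1/4\<close> half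
  of the cutoff energy is absorbed, so the total energy \<open>A\<close> is finite. With
  \<open>e\<close> arbitrary but fixed, the cross term sees only the energy outside growing boxes,
  which tends to zero; what remains is \<open>2 * A \<le> K / (4 * e)\<close>, and a large
  \<open>e\<close> excludes \<open>A > 0\<close>.\<close>

lemma energy_zero:
  assumes dim: "DIM('a) \<le> 2"
  shows "AE p in lborel. energy p = 0"
proof -
  obtain K where K: "\<And>R. 1 \<le> R \<Longrightarrow> R0 \<le> R \<Longrightarrow>
      (\<integral>p. (ratio (fst p) + ratio (snd p))\<^sup>2 * (tent R (fst p) - tent R (snd p))\<^sup>2 * weight p * k (fst p - snd p) \<partial>lborel) \<le> K"
    using tent_energy_bounded[OF dim] by blast
  define N where "N = max 1 R0"
  define R where "R = (\<lambda>n::nat. N + real n)"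
  define B where "B = (\<lambda>n. cball (0::'a) (R n) \<times> cball (0::'a) (R n))"
  define P where "P = (\<lambda>n p. (ratio (fst p) - ratio (snd p))\<^sup>2 * ((tent (R n) (fst p))\<^sup>2 + (tent (R n) (snd p))\<^sup>2)
      * weight p * k (fst p - snd p))"
  define Q where "Q = (\<lambda>n p. (ratio (fst p) + ratio (snd p))\<^sup>2 * (tent (R n) (fst p) - tent (R n) (snd p))\<^sup>2
      * weight p * k (fst p - snd p))"
  define X where "X = (\<lambda>n p. - ((ratio (fst p))\<^sup>2 - (ratio (snd p))\<^sup>2) * ((tent (R n) (fst p))\<^sup>2 - (tent (R n) (snd p))\<^sup>2)
      * weight p * k (fst p - snd p))"
  have R: "0 < R n" "1 \<le> R n" "R0 \<le> R n" for n
    by (auto simp: R_def N_def)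
  have P_int: "integrable lborel (P n)" for n
    unfolding P_def by (rule energy_tent_integrable[OF R(1)])
  have Q_int: "integrable lborel (Q n)" for n
    unfolding Q_def by (rule integrable_pair[where S = "2 * R n"])
      (auto simp: tent_outer R intro!: cont_intros)
  have X_int: "integrable lborel (X n)" for n
    unfolding X_def by (rule integrable_pair[where S = "2 * R n"])
      (auto simp: tent_outer R intro!: cont_intros)
  have B_int: "integrable lborel (\<lambda>p. energy p * indicat_real (B n) p)" for n
    unfolding B_def by (rule energy_box_integrable[OF R(1)])
  have QK: "(\<integral>p. Q n p \<partial>lborel) \<le> K" for n
    unfolding Q_def by (rule K[OF R(2,3)])
  have BP: "2 * (\<integral>p. energy p * indicat_real (B n) p \<partial>lborel) \<le> (\<integral>p. P n p \<partial>lborel)" for n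
    unfolding B_def P_def by (rule energy_box_le[OF R(1)])
  have PX: "(\<integral>p. P n p \<partial>lborel) = (\<integral>p. X n p \<partial>lborel)" for n
    unfolding P_def X_def
    by (rule energy_identity[where S = "2 * R n"]) (auto simp: tent_outer R intro!: continuous_intros)
  have X_le: "X n p \<le> e * ((tent (R n) (fst p) + tent (R n) (snd p))\<^sup>2 * energy p) + Q n p / (4 * e)"
    if "0 < e" for e n p
    using mult_right_mono[OF young_cutoff[OF that, of "ratio (fst p)" "ratio (snd p)" "tent (R n) (fst p)" "tent (R n) (snd p)"],
        of "weight p * k (fst p - snd p)"] v_pos[of "fst p"] v_pos[of "snd p"] k_nonneg[of "fst p - snd p"]
    by (simp add: X_def Q_def energy_def algebra_simps)
  \<comment> \<open>By (s + t)^2 \<le> 2 (s^2 + t^2), the first Young term is at most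
    \<open>2 * e\<close> times \<open>P n p\<close>. The choice \<open>e = 1/4\<close> makes this
    one half, which the left side absorbs, and leaves \<open>Q n p\<close> with coefficient
    1.\<close>
  have P_bound: "(\<integral>p. P n p \<partial>lborel) \<le> 2 * K" for n
  proof -
    have "(\<integral>p. X n p \<partial>lborel) \<le> (\<integral>p. P n p / 2 + Q n p \<partial>lborel)"
    proof (rule Bochner_Integration.integral_mono[OF X_int])
      show "integrable lborel (\<lambda>p. P n p / 2 + Q n p)"
        using P_int Q_int by simp
      show "X n p \<le> P n p / 2 + Q n p" for p
      proof -
        have "(tent (R n) (fst p) + tent (R n) (snd p))\<^sup>2 \<le> 2 * ((tent (R n) (fst p))\<^sup>2 + (tent (R n) (snd p))\<^sup>2)"
          using zero_le_power2[of "tent (R n) (fst p) - tent (R n) (snd p)"]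
          by (simp add: power2_eq_square algebra_simps)
        note le = mult_right_mono[OF this energy_nonneg[of p]]
        have "X n p \<le> 1 / 4 * ((tent (R n) (fst p) + tent (R n) (snd p))\<^sup>2 * energy p) + Q n p"
          using X_le[of "1/4" n p] by simp
        also have "\<dots> \<le> 1 / 4 * (2 * ((tent (R n) (fst p))\<^sup>2 + (tent (R n) (snd p))\<^sup>2) * energy p) + Q n p"
          by (intro add_right_mono mult_left_mono le) simp
        also have "\<dots> = P n p / 2 + Q n p"
          by (simp add: P_def energy_def mult_ac)
        finally show ?thesis .
      qed
    qed
    also have "\<dots> = (\<integral>p. P n p \<partial>lborel) / 2 + (\<integral>p. Q n p \<partial>lborel)"
      using P_int Q_int by simp
    finally show ?thesis
      using PX[of n] QK[of n] by linarith
  qed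
  have B_mono: "B m \<subseteq> B n" if "m \<le> n" for m n
    using that by (force simp: B_def R_def)
  have mono: "mono (\<lambda>n. energy p * indicat_real (B n) p)" for p
  proof (rule monoI)
    fix m n :: nat assume "m \<le> n"
    then have "indicat_real (B m) p \<le> indicat_real (B n) p"
      using B_mono[of m n] by (auto simp: indicator_def)
    then show "energy p * indicat_real (B m) p \<le> energy p * indicat_real (B n) p"
      by (intro mult_left_mono energy_nonneg)
  qed
  have ptw: "(\<lambda>n. energy p * indicat_real (B n) p) \<longlonglongrightarrow> energy p" for p
  proof -
    obtain m where m: "max (norm (fst p)) (norm (snd p)) \<le> real m"
      using real_arch_simple by blast
    have "p \<in> B n" if "m \<le> n" for n
      using m that by (cases p) (auto simp: B_def R_def N_def)
    then have "eventually (\<lambda>n. energy p * indicat_real (B n) p = energy p) sequentially"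
      by (auto simp: eventually_sequentially intro!: exI[of _ m])
    then show ?thesis
      by (rule tendsto_eventually)
  qed
  have incs: "incseq (\<lambda>n. \<integral>p. energy p * indicat_real (B n) p \<partial>lborel)"
    using mono B_int by (intro incseq_SucI Bochner_Integration.integral_mono) (auto simp: mono_iff_le_Suc)
  have "(\<integral>p. energy p * indicat_real (B n) p \<partial>lborel) \<le> K" for n
    using BP[of n] P_bound[of n] by linarith
  then have "\<forall>n. (\<integral>p. energy p * indicat_real (B n) p \<partial>lborel) \<le> K"
    by blast
  then obtain A where A: "(\<lambda>n. \<integral>p. energy p * indicat_real (B n) p \<partial>lborel) \<longlonglongrightarrow> A"
    by (rule incseq_convergent[OF incs])
  have meas: "energy \<in> borel_measurable lborel"
    using energy_measurable by simp
  have E: "integrable lborel energy" and EA: "(\<integral>p. energy p \<partial>lborel) = A"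
    by (rule integrable_monotone_convergence[OF B_int AE_I2[OF mono] AE_I2[OF ptw] A meas],
        rule integral_monotone_convergence[OF B_int AE_I2[OF mono] AE_I2[OF ptw] A meas])
  have lim: "2 * A \<le> K / (4 * e)" if "0 < e" for e
  proof -
    have *: "2 * (\<integral>p. energy p * indicat_real (B n) p \<partial>lborel)
        \<le> 4 * e * (A - (\<integral>p. energy p * indicat_real (B n) p \<partial>lborel)) + K / (4 * e)" for n
    proof -
      \<comment> \<open>Inside the box both tents are 1, so \<open>X\<close> and \<open>Q\<close>
        vanish there; outside, (s + t)^2 \<le> 4 produces the coefficient \<open>4 * e\<close> of
        the tail energy.\<close>
      let ?H = "\<lambda>p. 4 * e * (energy p - energy p * indicat_real (B n) p) + Q n p / (4 * e)"
      have "(\<integral>p. X n p \<partial>lborel) \<le> (\<integral>p. ?H p \<partial>lborel)"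
      proof (rule Bochner_Integration.integral_mono[OF X_int])
        show "integrable lborel ?H"
          using E B_int Q_int by simp
        show "X n p \<le> ?H p" for p
        proof (cases "p \<in> B n")
          case True
          then have "tent (R n) (fst p) = 1" "tent (R n) (snd p) = 1"
            using R(1) by (auto simp: B_def tent_inner)
          then show ?thesis
            using True by (simp add: X_def Q_def)
        next
          case False
          have "(tent (R n) (fst p) + tent (R n) (snd p))\<^sup>2 \<le> 2\<^sup>2"
            using tent_nonneg[of "R n" "fst p"] tent_nonneg[of "R n" "snd p"]
              tent_le_1[of "R n" "fst p"] tent_le_1[of "R n" "snd p"] by (intro power_mono) auto
          from mult_right_mono[OF this energy_nonneg[of p]]
          have "(tent (R n) (fst p) + tent (R n) (snd p))\<^sup>2 * energy p \<le> 4 * energy p"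
            by simp
          from mult_left_mono[OF this, of e]
          have "e * ((tent (R n) (fst p) + tent (R n) (snd p))\<^sup>2 * energy p) \<le> 4 * e * energy p"
            using that by (simp only: mult_ac less_imp_le)
          then show ?thesis
            using False X_le[OF that, of n p] by simp
        qed
      qed
      also have "\<dots> = 4 * e * (A - (\<integral>p. energy p * indicat_real (B n) p \<partial>lborel)) + (\<integral>p. Q n p \<partial>lborel) / (4 * e)"
        using E B_int Q_int EA by simp
      also have "\<dots> \<le> 4 * e * (A - (\<integral>p. energy p * indicat_real (B n) p \<partial>lborel)) + K / (4 * e)"
        using QK[of n] that by (simp add: divide_right_mono)
      finally show ?thesis
        using BP[of n] PX[of n] by linarith
    qed
    \<comment> \<open>The limit in \<open>n\<close> is taken with \<open>e\<close> fixed, so the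
      tail disappears however large \<open>e\<close> is.\<close>
    have "2 * A \<le> 4 * e * (A - A) + K / (4 * e)"
      by (rule LIMSEQ_le[OF tendsto_mult[OF tendsto_const A]
            tendsto_add[OF tendsto_mult[OF tendsto_const tendsto_diff[OF tendsto_const A]] tendsto_const]])
        (use * in blast)
    then show ?thesis by simp
  qed
  have "A \<le> 0"
  proof (rule ccontr)
    assume "\<not> A \<le> 0"
    then have A0: "0 < A" by simp
    then have "0 < K / (4 * 1)"
      using lim[of 1] by linarith
    \<comment> \<open>For \<open>e = K / A\<close> the bound reads \<open>2 * A \<le> A / 4\<close>.
      The instance \<open>e = 1\<close> has secured \<open>K > 0\<close>, so this value is
      admissible.\<close>
    then have "0 < K / A"
      using A0 by simp
    from lim[OF this] A0 \<open>0 < K / (4 * 1)\<close> show False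
      by simp
  qed
  moreover have "0 \<le> (\<integral>p. energy p \<partial>lborel)"
    by (intro integral_nonneg_AE AE_I2 energy_nonneg)
  ultimately have "(\<integral>p. energy p \<partial>lborel) = 0"
    using EA by simp
  then show ?thesis
    using integral_nonneg_eq_0_iff_AE[OF E] energy_nonneg by simp
qed

text \<open>Where \<open>k\<close> is positive, zero energy forces equal ratios at almost every pair
  closer than \<open>r0\<close>. By continuity the exceptional pairs form an open set, and an open
  null set is empty. So \<open>ratio\<close> is locally constant, and connectedness of the space
  does the rest.\<close>

lemma ratio_constant:
  assumes dim: "DIM('a) \<le> 2" and r0: "0 < r0" and k_pos: "\<And>z. norm z < r0 \<Longrightarrow> 0 < k z"
  obtains a where "\<And>x. w x = a * v x"
proof -
  define U where "U = {p. norm (fst p - snd p) < r0} \<inter> {p. ratio (fst p) \<noteq> ratio (snd p)}"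
  have "open U"
    unfolding U_def
    by (intro open_Int open_Collect_less open_Collect_neq cont_intros) auto
  have "AE p in lborel. p \<notin> U"
    using energy_zero[OF dim]
  proof eventually_elim
    case (elim p)
    then show ?case
      using v_pos[of "fst p"] v_pos[of "snd p"] k_pos[of "fst p - snd p"] by (auto simp: U_def energy_def)
  qed
  then have "U \<in> null_sets lborel"
    using \<open>open U\<close> by (simp add: AE_iff_null_sets)
  then have "negligible U"
    by (simp add: negligible_iff_null_sets null_sets_completionI)
  then have "U = {}"
    using \<open>open U\<close> open_not_negligible by blast
  then have loc: "ratio x = ratio y" if "norm (x - y) < r0" for x y
  proof -
    have "(x, y) \<notin> U"
      using \<open>U = {}\<close> by simp
    then show ?thesis
      using that by (simp add: U_def)
  qed
  have "ratio constant_on UNIV"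
  proof (rule locally_constant_imp_constant)
    show "\<exists>T. openin (top_of_set UNIV) T \<and> a \<in> T \<and> (\<forall>x\<in>T. ratio x = ratio a)" for a
      using r0 loc by (intro exI[of _ "ball a r0"]) (auto simp: dist_norm norm_minus_commute)
  qed auto
  then obtain a where "\<And>x. ratio x = a"
    by (auto simp: constant_on_def)
  then show ?thesis
    using that w_eq by metis
qed

end


section \<open>Replacing the kernel by an even Borel representative\<close>

text \<open>Completeness of the measure makes \<open>h\<close> measurable. This carries the
  integrals of the theorem, taken over \<open>lebesgue\<close>, to \<open>lborel\<close>.\<close>

lemma integral_lebesgue_eq_lborel:
  fixes g h :: "'a::euclidean_space \<Rightarrow> real"
  assumes g: "g \<in> borel_measurable borel" and ae: "AE y in lborel. h y = g y"
  shows "(\<integral>y. h y \<partial>lebesgue) = (\<integral>y. g y \<partial>lborel)"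
proof -
  have gl: "g \<in> borel_measurable lborel"
    using g by simp
  have ae': "AE y in lebesgue. g y = h y"
    using AE_completion[OF ae] by eventually_elim simp
  have "(\<integral>y. h y \<partial>lebesgue) = (\<integral>y. g y \<partial>lebesgue)"
    using ae' borel_measurable_AE[OF measurable_completion[OF gl] ae'] measurable_completion[OF gl]
    by (intro integral_cong_AE) (auto elim: eventually_mono)
  then show ?thesis
    by (simp add: integral_completion[OF gl])
qed

text \<open>A Borel function equal to \<open>k\<close> almost everywhere may break the bounds and
  the symmetry on a null set. Clamping it between \<open>l\<close> and \<open>h\<close> restores the
  bounds, averaging over \<open>z\<close> and \<open>- z\<close> restores evenness, and neither
  changes it almost everywhere.\<close>

lemma even_borel_representative:
  fixes k l h :: "'a::euclidean_space \<Rightarrow> real"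
  assumes k: "k \<in> borel_measurable lebesgue" "\<And>z. k (- z) = k z"
    and l: "l \<in> borel_measurable borel" "\<And>z. l (- z) = l z" "\<And>z. l z \<le> k z"
    and h: "h \<in> borel_measurable borel" "\<And>z. h (- z) = h z" "\<And>z. k z \<le> h z"
  obtains k' where "k' \<in> borel_measurable borel" "\<And>z. k' (- z) = k' z"
    "\<And>z. l z \<le> k' z" "\<And>z. k' z \<le> h z" "AE z in lborel. k z = k' z"
proof -
  obtain k1 where k1: "k1 \<in> borel_measurable lborel" "AE z in lborel. k z = k1 z"
    using completion_ex_borel_measurable_real[OF k(1)] by blast
  define k2 where "k2 z = max (l z) (min (h z) (k1 z))" for z
  have k2_borel: "k2 \<in> borel_measurable borel"
    using k1(1) l(1) h(1) unfolding k2_def[abs_def] by simp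
  have lk: "l z \<le> k2 z" "k2 z \<le> h z" for z
    using order_trans[OF l(3) h(3), of z] by (auto simp: k2_def)
  show ?thesis
  proof
    show "(\<lambda>z. (k2 z + k2 (- z)) / 2) \<in> borel_measurable borel"
      using k2_borel by (intro borel_measurable_divide borel_measurable_add borel_measurable_const
          measurable_compose[OF _ k2_borel]) auto
    show "(k2 (- z) + k2 (- (- z))) / 2 = (k2 z + k2 (- z)) / 2" for z
      by simp
    show "l z \<le> (k2 z + k2 (- z)) / 2" "(k2 z + k2 (- z)) / 2 \<le> h z" for z
      using lk[of z] lk[of "- z"] l(2)[of z] h(2)[of z] by auto
    show "AE z in lborel. k z = (k2 z + k2 (- z)) / 2"
      \<comment> \<open>The exceptional null set is discarded together with its reflection;
        elsewhere the bounds on \<open>k\<close> make the clamping inactive at both \<open>z\<close>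
        and \<open>- z\<close>.\<close>
      using k1(2) AE_lborel_reflect[OF k1(2), of 0]
    proof eventually_elim
      case (elim z)
      have "k2 z = k z" "k2 (- z) = k z"
        using elim l(3)[of z] h(3)[of z] l(3)[of "- z"] h(3)[of "- z"] k(2)[of z]
        by (auto simp: k2_def)
      then show ?case by simp
    qed
  qed
qed

section \<open>Directional derivatives and differentiation of a convolution\<close>

lemma has_derivative_line:
  fixes u :: "'a::real_normed_vector \<Rightarrow> real"
  assumes "(u has_derivative u') (at (x + t *\<^sub>R e))"
  shows "((\<lambda>s. u (x + s *\<^sub>R e)) has_real_derivative u' e) (at t)"
proof -
  have "((\<lambda>s. x + s *\<^sub>R e) has_derivative (\<lambda>s. s *\<^sub>R e)) (at t)"
    by (auto intro!: derivative_eq_intros)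
  from has_derivative_compose[OF this assms]
  have "((\<lambda>s. u (x + s *\<^sub>R e)) has_derivative (\<lambda>s. u' (s *\<^sub>R e))) (at t)" .
  moreover have "u' (s *\<^sub>R e) = u' e * s" for s
    using has_derivative_linear[OF assms] by (simp add: linear_cmul)
  ultimately show ?thesis
    by (simp add: has_field_derivative_def)
qed

lemma partial_deriv_eq:
  assumes "(u has_derivative u') (at x)"
  shows "partial_deriv i u x = u' (axis i 1)"
  unfolding partial_deriv_def
  by (intro DERIV_imp_deriv has_derivative_line) (simp add: assms)

text \<open>As \<open>k\<close> is merely measurable, the substitution of \<open>x - z\<close> for
  \<open>y\<close> first moves the translation onto \<open>u\<close>. The difference quotients of
  \<open>u\<close> are then bounded by \<open>L\<close>, so \<open>L * k z\<close> dominates and the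
  limit passes under the integral.\<close>

lemma (in finite_range_kernel) conv_has_derivative:
  fixes u d :: "'a \<Rightarrow> real"
  assumes u: "continuous_on UNIV u" and d: "continuous_on UNIV d" and L: "\<And>x. \<bar>d x\<bar> \<le> L"
    and deriv: "\<And>x t. ((\<lambda>s. u (x + s *\<^sub>R e)) has_real_derivative d (x + t *\<^sub>R e)) (at t)"
  shows "((\<lambda>t. \<integral>y. u y * k (x + t *\<^sub>R e - y) \<partial>lborel) has_real_derivative (\<integral>y. d y * k (x - y) \<partial>lborel)) (at 0)"
proof -
  have refl: "(\<integral>y. g y * k (x - y) \<partial>lborel) = (\<integral>z. g (x - z) * k z \<partial>lborel)"
    and refl_int: "integrable lborel (\<lambda>z. g (x - z) * k z)" if g: "continuous_on UNIV g" for g :: "'a \<Rightarrow> real" and x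
  proof -
    have [measurable]: "g \<in> borel_measurable borel"
      using g by (rule borel_measurable_continuous_onI)
    show "(\<integral>y. g y * k (x - y) \<partial>lborel) = (\<integral>z. g (x - z) * k z \<partial>lborel)"
      using integral_reflect[of "\<lambda>z. g (x - z) * k z" x] by simp
    have "integrable lborel (\<lambda>z. g (x - z) * k (0 - z))"
      by (intro integrable_conv continuous_on_compose2[OF g] continuous_intros) auto
    then show "integrable lborel (\<lambda>z. g (x - z) * k z)"
      by (simp add: k_even)
  qed
  have lip: "\<bar>u (x + t *\<^sub>R e) - u x\<bar> \<le> L * \<bar>t\<bar>" for x t
    using field_differentiable_bound[of UNIV "\<lambda>s. u (x + s *\<^sub>R e)" "\<lambda>t. d (x + t *\<^sub>R e)" L t 0] deriv L
    by simp
  have "((\<lambda>t. \<integral>z. u (x + t *\<^sub>R e - z) * k z \<partial>lborel) has_real_derivative (\<integral>z. d (x - z) * k z \<partial>lborel)) (at 0)"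
    unfolding has_field_derivative_iff tendsto_at_iff_sequentially o_def
  proof (intro allI impI)
    fix X :: "nat \<Rightarrow> real"
    assume "\<forall>i. X i \<in> UNIV - {0}" and X: "X \<longlonglongrightarrow> 0"
    then have X0: "X i \<noteq> 0" for i
      by auto
    have "(\<lambda>i. \<integral>z. (u (x + X i *\<^sub>R e - z) * k z - u (x - z) * k z) / X i \<partial>lborel) \<longlonglongrightarrow> (\<integral>z. d (x - z) * k z \<partial>lborel)"
    proof (rule integral_dominated_convergence[where w = "\<lambda>z. L * k z"])
      show "(\<lambda>z. d (x - z) * k z) \<in> borel_measurable lborel"
        using refl_int[OF d] by (rule borel_measurable_integrable)
      show "(\<lambda>z. (u (x + X i *\<^sub>R e - z) * k z - u (x - z) * k z) / X i) \<in> borel_measurable lborel" for i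
        using refl_int[OF u] by (intro borel_measurable_integrable integrable_divide_zero
          Bochner_Integration.integrable_diff impI)
      show "integrable lborel (\<lambda>z. L * k z)"
        using refl_int[of "\<lambda>_. 1"] by simp
      show "AE z in lborel. norm ((u (x + X i *\<^sub>R e - z) * k z - u (x - z) * k z) / X i) \<le> L * k z" for i
      proof (intro AE_I2)
        fix z
        have "\<bar>u (x + X i *\<^sub>R e - z) - u (x - z)\<bar> / \<bar>X i\<bar> \<le> L"
          using lip[of "x - z" "X i"] X0[of i] by (simp add: field_simps)
        from mult_right_mono[OF this k_nonneg[of z]]
        show "norm ((u (x + X i *\<^sub>R e - z) * k z - u (x - z) * k z) / X i) \<le> L * k z"
          using k_nonneg[of z] by (simp add: left_diff_distrib[symmetric] abs_mult)
      qed
      show "AE z in lborel. (\<lambda>i. (u (x + X i *\<^sub>R e - z) * k z - u (x - z) * k z) / X i) \<longlonglongrightarrow> d (x - z) * k z"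
      proof (intro AE_I2)
        fix z
        have "(\<lambda>i. (u (x - z + X i *\<^sub>R e) - u (x - z)) / X i) \<longlonglongrightarrow> d (x - z)"
          using deriv[of "x - z" 0] X X0
          unfolding has_field_derivative_iff tendsto_at_iff_sequentially o_def by simp
        from tendsto_mult_right[OF this, of "k z"]
        show "(\<lambda>i. (u (x + X i *\<^sub>R e - z) * k z - u (x - z) * k z) / X i) \<longlonglongrightarrow> d (x - z) * k z"
          by (simp add: algebra_simps diff_divide_distrib)
      qed
    qed
    then show "(\<lambda>i. ((\<integral>z. u (x + X i *\<^sub>R e - z) * k z \<partial>lborel) - (\<integral>z. u (x + 0 *\<^sub>R e - z) * k z \<partial>lborel)) / (X i - 0))
        \<longlonglongrightarrow> (\<integral>z. d (x - z) * k z \<partial>lborel)"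
      using refl_int[OF u] by simp
  qed
  then show ?thesis
    by (simp add: refl[OF u] refl[OF d])
qed

section \<open>From the nonlocal equation to one-dimensional symmetry\<close>

theorem theorem2:
  fixes k :: "real ^ 2 \<Rightarrow> real"
    and f :: "real \<Rightarrow> real"
    and u :: "real ^ 2 \<Rightarrow> real"
    and m0 M0 r0 R0 :: real
  assumes k_even: "\<And>z. k (- z) = k z"
    and k_meas: "k \<in> borel_measurable lebesgue"
    and k_int: "(\<integral>z. k z \<partial>lebesgue) = 1"
    and m0: "0 < m0" "m0 \<le> M0"
    and r0: "0 < r0" "r0 \<le> R0"
    and k_lower: "\<And>z. m0 * indicator (ball 0 r0) z \<le> k z"
    and k_upper: "\<And>z. k z \<le> M0 * indicator (ball 0 R0) z"
    and f_C1: "f C1_differentiable_on UNIV"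
    and u_C1: "C1_norm_finite u"
    and u_eq: "\<And>x. (\<integral>y. (u x - u y) * k (x - y) \<partial>lebesgue) = f (u x)"
    and u_mono: "\<And>x. partial_deriv 2 u x > 0"
  shows "one_dimensional u"
proof -
  obtain k' where k': "k' \<in> borel_measurable borel" "\<And>z. k' (- z) = k' z"
    "\<And>z. m0 * indicator (ball 0 r0) z \<le> k' z" "\<And>z. k' z \<le> M0 * indicator (ball 0 R0) z"
    and ae: "AE z in lborel. k z = k' z"
    by (rule even_borel_representative[OF k_meas k_even,
          of "\<lambda>z. m0 * indicator (ball 0 r0) z" "\<lambda>z. M0 * indicator (ball 0 R0) z"])
      (auto simp: k_lower k_upper split: split_indicator intro!: borel_measurable_times borel_measurable_indicator)
  interpret finite_range_kernel k' M0 R0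
  proof
    show "0 \<le> k' z" "k' z \<le> M0" for z
      using k'(3)[of z] k'(4)[of z] m0 by (auto split: split_indicator_asm)
    then show "k' z = 0" if "R0 \<le> norm z" for z
      using k'(4)[of z] that by (intro antisym) auto
  qed (use k' r0 in auto)
  obtain D where f_deriv: "\<And>s. (f has_real_derivative D s) (at s)" and D_cont: "continuous_on UNIV D"
    using f_C1 unfolding C1_differentiable_on_def
    by (auto simp: has_real_derivative_iff_has_vector_derivative)
  define du where "du x = frechet_derivative u (at x)" for x
  have du: "(u has_derivative du x) (at x)" for x
    using u_C1 by (simp add: du_def frechet_derivative_works[symmetric] C1_norm_finite_def C1_fun_def)
  have u_cont: "continuous_on UNIV u"
    using du has_derivative_continuous continuous_at_imp_continuous_on by blast
  have d_cont: "continuous_on UNIV (partial_deriv i u)" for i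
    using u_C1 by (simp add: C1_norm_finite_def C1_fun_def)
  obtain L where L: "\<And>i x. \<bar>partial_deriv i u x\<bar> \<le> L i"
    using u_C1 unfolding C1_norm_finite_def bounded_real by (metis rangeI)
  obtain U where U: "\<And>x. \<bar>u x\<bar> \<le> U"
    using u_C1 unfolding C1_norm_finite_def bounded_real by (metis rangeI)
  define c where "c x = 1 - D (u x)" for x
  \<comment> \<open>The derivative \<open>D\<close> of \<open>f\<close> is only continuous; a bound
    for \<open>c\<close> comes from the compact interval containing the values of
    \<open>u\<close>.\<close>
  have "bounded ((\<lambda>s. 1 - D s) ` {- U..U})"
    by (intro compact_imp_bounded compact_continuous_image continuous_intros continuous_on_subset[OF D_cont]) auto
  then obtain C where C: "\<And>s. s \<in> {- U..U} \<Longrightarrow> \<bar>1 - D s\<bar> \<le> C"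
    unfolding bounded_real ball_simps by blast
  have c_le: "c x \<le> C" for x
    using C[of "u x"] U[of x] by (auto simp: c_def abs_le_iff)
  \<comment> \<open>Unit mass of the kernel brings the equation into convolution form, ready to be
    differentiated.\<close>
  have conv: "(\<integral>y. u y * k' (x - y) \<partial>lborel) = u x - f (u x)" for x
  proof -
    have one: "(\<integral>y. k' (x - y) \<partial>lborel) = 1"
      using integral_reflect[OF k'(1)] integral_lebesgue_eq_lborel[OF k'(1) ae] k_int by simp
    have u_borel: "u \<in> borel_measurable borel"
      using u_cont by (rule borel_measurable_continuous_onI)
    have i1: "integrable lborel (\<lambda>y. k' (x - y))" and i2: "integrable lborel (\<lambda>y. u y * k' (x - y))"
      using integrable_conv[of "\<lambda>_. 1" x] integrable_conv[OF u_cont, of x] by auto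
    have "(\<integral>y. (u x - u y) * k (x - y) \<partial>lebesgue) = (\<integral>y. (u x - u y) * k' (x - y) \<partial>lborel)"
      using AE_lborel_reflect[OF ae, of x] k'(1) u_borel
      by (intro integral_lebesgue_eq_lborel) (auto elim: eventually_mono)
    also have "\<dots> = (\<integral>y. u x * k' (x - y) - u y * k' (x - y) \<partial>lborel)"
      by (simp add: left_diff_distrib)
    also have "\<dots> = u x - (\<integral>y. u y * k' (x - y) \<partial>lborel)"
      using i1 i2 one by simp
    finally show ?thesis
      using u_eq[of x] by simp
  qed
  \<comment> \<open>By \<open>conv\<close> the function \<open>u - f \<circ> u\<close> on a
    coordinate line is a convolution. Its derivative, computed under the integral and by the chain
    rule, must agree.\<close>
  have lin: "(\<integral>y. partial_deriv i u y * k' (x - y) \<partial>lborel) = c x * partial_deriv i u x" for i x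
  proof (rule DERIV_unique)
    have line: "((\<lambda>s. u (x + s *\<^sub>R axis i 1)) has_real_derivative partial_deriv i u (x + t *\<^sub>R axis i 1)) (at t)" for x t
      unfolding partial_deriv_eq[OF du] by (rule has_derivative_line[OF du])
    show "((\<lambda>t. u (x + t *\<^sub>R axis i 1) - f (u (x + t *\<^sub>R axis i 1))) has_real_derivative
        (\<integral>y. partial_deriv i u y * k' (x - y) \<partial>lborel)) (at 0)"
      using conv_has_derivative[OF u_cont d_cont L line, of x] by (simp only: conv)
    show "((\<lambda>t. u (x + t *\<^sub>R axis i 1) - f (u (x + t *\<^sub>R axis i 1))) has_real_derivative
        c x * partial_deriv i u x) (at 0)"
      using DERIV_diff[OF line[of x 0] DERIV_chain2[OF f_deriv line[of x 0]]]
      by (simp add: c_def algebra_simps)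
  qed
  interpret kernel_pair k' M0 R0 "partial_deriv 2 u" "partial_deriv 1 u" c "L 1" C
    by unfold_locales (auto simp: d_cont u_mono L c_le lin)
  have "0 < k' z" if "norm z < r0" for z
    using k'(3)[of z] m0(1) that by simp
  then obtain a where a: "\<And>x. partial_deriv 1 u x = a * partial_deriv 2 u x"
    using ratio_constant[OF _ r0(1)] by auto
  \<comment> \<open>The derivative of \<open>u\<close> along \<open>e\<close> is
    \<open>partial_deriv 1 u x - a * partial_deriv 2 u x\<close>, which is zero.\<close>
  define e :: "real ^ 2" where "e = axis 1 1 - a *\<^sub>R axis 2 1"
  have "du x e = 0" for x
    using a[of x] has_derivative_linear[OF du, of x]
    by (simp add: e_def linear_diff linear_cmul partial_deriv_eq[OF du])
  then have "((\<lambda>s. u (x + s *\<^sub>R e)) has_real_derivative 0) (at t)" for x t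
    using has_derivative_line[OF du, where x = x and t = t and e = e] by simp
  then have const: "u (x + s *\<^sub>R e) = u x" for x s
    using DERIV_isconst_all[of "\<lambda>s. u (x + s *\<^sub>R e)" s 0] by simp
  have "u x = u (((a *\<^sub>R axis 1 1 + axis 2 1) \<bullet> x) *\<^sub>R axis 2 1)" for x
  proof -
    \<comment> \<open>Sliding along \<open>e\<close> by minus the first coordinate lands on the
      second axis, at height \<open>a * x $ 1 + x $ 2\<close>; this is the variable of the
      profile.\<close>
    have "x + (- x $ 1) *\<^sub>R e = ((a *\<^sub>R axis 1 1 + axis 2 1) \<bullet> x) *\<^sub>R axis 2 1"
      by (simp add: e_def vec_eq_iff forall_2 axis_def inner_vec_def sum_2)
    then show ?thesis
      using const[of x "- x $ 1"] by simp
  qed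
  then show ?thesis
    unfolding one_dimensional_def
    by (intro exI[of _ "\<lambda>s. u (s *\<^sub>R axis 2 1)"] exI[of _ "a *\<^sub>R axis 1 1 + axis 2 1"]) blast
qed

end
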